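(* Let $G$ be a connected graph on $n\geq 4$ vertices. Then $m_G(-1)+m_G(-2)=n-2$ if and only if $G$ is isomorphic to the complete bipartite graph $K_{s,n-s}$ for some $1\leq s\leq n-1$, or to $K_s^c\vee K_{n-s}$ for some $2\leq s\leq n-2$.
   Context: All graphs are finite, simple and undirected. For a connected graph $G$, the distance matrix $D(G)$ has $(u,v)$-entry equal to the length of a shortest $u$–$v$ path. $m_G(\partial)$ denotes the multiplicity of $\partial$ as an eigenvalue of $D(G)$ (taken to be $0$ if $\partial$ is not an eigenvalue). $K_m$ is the complete graph on $m$ vertices, $K_m^c$ the edgeless graph on $m$ vertices, and $G_1\vee G_2$ is the join (disjoint union plus all edges between $G_1$ and $G_2$). *)

theory Defs
  imports "Graph_Theory.Graph_Theory" "Jordan_Normal_Form.Char_Poly"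
begin

text \<open>A finite simple undirected graph is a \<^locale>\<open>pair_graph\<close>: a finite, loop-free digraph
  without parallel arcs whose arc relation is symmetric, each edge being a pair of opposite arcs.\<close>

definition graph_dist :: "'a pair_pre_digraph \<Rightarrow> 'a \<Rightarrow> 'a \<Rightarrow> nat" where
  "graph_dist G u v = (LEAST k. \<exists>p. pre_digraph.apath (with_proj G) u p v \<and> length p = k)"

text \<open>The list \<open>vs\<close> enumerates the vertices without repetition and fixes the order of the rows and
  columns.\<close>

definition distance_matrix :: "'a pair_pre_digraph \<Rightarrow> 'a list \<Rightarrow> real mat" where
  "distance_matrix G vs =
     mat (length vs) (length vs) (\<lambda>(i, j). real (graph_dist G (vs ! i) (vs ! j)))"

text \<open>Multiplicity as a root of the characteristic polynomial; it is \<open>0\<close> if \<open>c\<close> is not an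
  eigenvalue.\<close>

definition eigenvalue_mult :: "real mat \<Rightarrow> real \<Rightarrow> nat" where
  "eigenvalue_mult A c = order c (char_poly A)"

definition complete_graph :: "nat \<Rightarrow> nat pair_pre_digraph" where
  "complete_graph m = \<lparr> pverts = {..<m}, parcs = {(u, v). u < m \<and> v < m \<and> u \<noteq> v} \<rparr>"

definition edgeless_graph :: "nat \<Rightarrow> nat pair_pre_digraph" where
  "edgeless_graph m = \<lparr> pverts = {..<m}, parcs = {} \<rparr>"

definition graph_join :: "'a pair_pre_digraph \<Rightarrow> 'b pair_pre_digraph \<Rightarrow> ('a + 'b) pair_pre_digraph"
  where
  "graph_join G H =
     \<lparr> pverts = pverts G <+> pverts H,
       parcs = {(Inl u, Inl v) | u v. (u, v) \<in> parcs G} \<union> {(Inr u, Inr v) | u v. (u, v) \<in> parcs H}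
         \<union> (Inl ` pverts G) \<times> (Inr ` pverts H) \<union> (Inr ` pverts H) \<times> (Inl ` pverts G) \<rparr>"

lemma complete_digraph_complete_graph: "complete_digraph m (with_proj (complete_graph m))"
  unfolding complete_digraph_pair_def by (auto simp: complete_graph_def)

lemma pair_graph_complete_graph: "pair_graph (complete_graph m)"
  by (rule pair_graphI_complete[OF complete_digraph_complete_graph])

lemma pair_graph_edgeless_graph: "pair_graph (edgeless_graph m)"
  by unfold_locales (auto simp: edgeless_graph_def symmetric_def sym_def)

lemma pair_graph_graph_join:
  assumes "pair_graph G" "pair_graph H"
  shows "pair_graph (graph_join G H)"
proof -
  interpret G: pair_graph G by fact
  interpret H: pair_graph H by fact
  have "finite (pverts G)" "finite (pverts H)" "finite (parcs G)" "finite (parcs H)"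
    by (simp_all add: G.pair_finite_verts H.pair_finite_verts
        G.pair_finite_arcs H.pair_finite_arcs)
  moreover have "sym (parcs G)" "sym (parcs H)"
    using G.pair_sym_arcs H.pair_sym_arcs by (simp_all add: symmetric_def)
  moreover have "(u, u) \<notin> parcs G" for u using G.pair_no_loops[of "(u, u)"] by auto
  moreover have "(u, u) \<notin> parcs H" for u using H.pair_no_loops[of "(u, u)"] by auto
  moreover have "parcs (graph_join G H) \<subseteq> pverts (graph_join G H) \<times> pverts (graph_join G H)"
    by (auto simp: graph_join_def dest: G.wellformed' H.wellformed')
  moreover have "finite (pverts (graph_join G H))"
    using calculation by (simp add: graph_join_def)
  moreover have "finite (parcs (graph_join G H))"
    using calculation by (meson finite_SigmaI rev_finite_subset)
  moreover have "sym (parcs (graph_join G H))"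
    using calculation(5,6) by (auto simp: graph_join_def sym_def)
  moreover have "(u, u) \<notin> parcs (graph_join G H)" for u
    using calculation(7,8) by (auto simp: graph_join_def)
  ultimately show ?thesis
    by unfold_locales (force simp: symmetric_def)+
qed

end

theory Submission
  imports Defs
begin

text \<open>The distance matrix \<open>D\<close> is real symmetric, hence orthogonally diagonalisable, and the multiplicity
  condition says that exactly two of its eigenvalues lie outside \<open>{-1, -2}\<close>. A graph that is not
  complete contains an induced path on three vertices, on which \<open>D + I\<close> is positive definite on a
  plane; so at least two eigenvalues exceed \<open>-1\<close>. If only two eigenvalues are exceptional, these are
  the ones, and \<open>D + 2I\<close> is positive semidefinite. For nonadjacent \<open>u \<noteq> w\<close> its form takes the value
  \<open>4 - 2 d(u,w) \<le> 0\<close> at \<open>e\<^sub>u - e\<^sub>w\<close>, so this vector lies in the kernel and \<open>u\<close>, \<open>w\<close> are twins: the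
  graph is complete multipartite. An induced \<open>K\<^bsub>1,2,2\<^esub>\<close> would give a third eigenvalue above \<open>-1\<close>, which
  leaves only the two families. Conversely, in both families \<open>(D + I)(D + 2I)\<close> annihilates every vector
  whose entries sum to zero on each of the two classes, so at most two eigenvalues are exceptional.\<close>

section \<open>The spectral theorem for real symmetric matrices\<close>

text \<open>The Hermitian form \<open>q\<close> at an eigenvector \<open>v\<close> equals
  \<open>k\<close> times the squared length \<open>r\<close> of \<open>v\<close>. Exchanging the two
  indices shows that \<open>q\<close> is its own conjugate when the matrix is real and symmetric,
  and \<open>r > 0\<close> then makes \<open>k\<close> real.\<close>

lemma symmetric_complex_eigenvalue_real:
  fixes A :: "real mat"
  assumes A: "A \<in> carrier_mat n n" and sym: "A\<^sup>T = A"
    and k: "eigenvalue (map_mat complex_of_real A) k"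
  shows "k \<in> \<real>"
proof -
  let ?A = "map_mat complex_of_real A"
  obtain v where v: "v \<in> carrier_vec n" "v \<noteq> 0\<^sub>v n" "?A *\<^sub>v v = k \<cdot>\<^sub>v v"
    using k A unfolding eigenvalue_def eigenvector_def by auto
  have symA: "A $$ (i, j) = A $$ (j, i)" if "i < n" "j < n" for i j
    using A sym that by (metis carrier_matD index_transpose_mat(1))
  define q where "q = (\<Sum>i<n. \<Sum>j<n. cnj (v $ i) * of_real (A $$ (i, j)) * v $ j)"
  define r where "r = (\<Sum>i<n. (cmod (v $ i))\<^sup>2)"
  have row: "(\<Sum>j<n. of_real (A $$ (i, j)) * v $ j) = k * v $ i" if "i < n" for i
  proof -
    have "(?A *\<^sub>v v) $ i = (\<Sum>j<n. of_real (A $$ (i, j)) * v $ j)"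
      using A v(1) that by (auto simp: scalar_prod_def atLeast0LessThan intro!: sum.cong)
    then show ?thesis using v that by simp
  qed
  have "q = (\<Sum>i<n. cnj (v $ i) * (\<Sum>j<n. of_real (A $$ (i, j)) * v $ j))"
    unfolding q_def by (simp add: sum_distrib_left mult.assoc)
  also have "\<dots> = (\<Sum>i<n. cnj (v $ i) * (k * v $ i))" by (simp add: row)
  also have "\<dots> = (\<Sum>i<n. k * of_real ((cmod (v $ i))\<^sup>2))"
    by (intro sum.cong refl) (simp only: complex_norm_square, simp)
  also have "\<dots> = k * of_real r" unfolding r_def by (simp add: sum_distrib_left)
  finally have qk: "q = k * of_real r" .
  have "cnj q = (\<Sum>i<n. \<Sum>j<n. v $ i * of_real (A $$ (i, j)) * cnj (v $ j))"
    unfolding q_def by (simp add: cnj_sum)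
  also have "\<dots> = (\<Sum>j<n. \<Sum>i<n. v $ i * of_real (A $$ (i, j)) * cnj (v $ j))"
    by (rule sum.swap)
  also have "\<dots> = q"
    unfolding q_def by (intro sum.cong refl) (auto simp: symA)
  finally have "cnj q = q" .
  obtain i where i: "i < n" "v $ i \<noteq> 0" using v(1,2) by (metis eq_vecI carrier_vecD index_zero_vec)
  have "0 < (cmod (v $ i))\<^sup>2" using i by simp
  also have "\<dots> \<le> r" unfolding r_def using i by (intro member_le_sum) auto
  finally have "r > 0" .
  with qk \<open>cnj q = q\<close> have "cnj k = k" by auto
  then show ?thesis by (simp add: Reals_cnj_iff)
qed

text \<open>The fundamental theorem of algebra gives a complex root of the characteristic
  polynomial. By symmetry it is real, hence a root of the real characteristic polynomial, so an
  eigenvector exists over the reals and can be scaled to length one.\<close>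

lemma symmetric_unit_eigenvector_exists:
  fixes A :: "real mat"
  assumes A: "A \<in> carrier_mat n n" and sym: "A\<^sup>T = A" and n: "n > 0"
  obtains e v where "v \<in> carrier_vec n" "v \<bullet> v = 1" "A *\<^sub>v v = e \<cdot>\<^sub>v v"
proof -
  let ?A = "map_mat complex_of_real A"
  have cA: "?A \<in> carrier_mat n n" using A by simp
  have "\<not> constant (poly (char_poly ?A))"
    using degree_monic_char_poly[OF cA] n by (simp add: constant_degree)
  then obtain k where k: "poly (char_poly ?A) k = 0"
    using fundamental_theorem_of_algebra by blast
  then have "eigenvalue ?A k" using eigenvalue_root_char_poly[OF cA] by simp
  from symmetric_complex_eigenvalue_real[OF A sym this] obtain e where e: "k = of_real e"
    by (auto elim: Reals_cases)
  have "of_real (poly (char_poly A) e) = (0 :: complex)"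
    using k unfolding e of_real_hom.char_poly_hom[OF A] by simp
  then have "eigenvalue A e" using eigenvalue_root_char_poly[OF A] by simp
  then obtain w where w: "w \<in> carrier_vec n" "w \<noteq> 0\<^sub>v n" "A *\<^sub>v w = e \<cdot>\<^sub>v w"
    using A unfolding eigenvalue_def eigenvector_def by auto
  have pos: "w \<bullet> w > 0"
    using w conjugate_square_greater_0_vec[of w n] by simp
  let ?c = "1 / sqrt (w \<bullet> w)"
  show ?thesis
  proof
    show "?c \<cdot>\<^sub>v w \<in> carrier_vec n" using w by simp
    show "(?c \<cdot>\<^sub>v w) \<bullet> (?c \<cdot>\<^sub>v w) = 1" using w pos by (simp add: field_simps)
    show "A *\<^sub>v (?c \<cdot>\<^sub>v w) = e \<cdot>\<^sub>v (?c \<cdot>\<^sub>v w)"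
      using A w by (simp add: mult_mat_vec smult_smult_assoc mult.commute)
  qed
qed

text \<open>The Householder reflection that swaps \<open>v\<close> and the first unit vector. If they are equal, the
  coefficient \<open>2 / 0\<close> is \<open>0\<close> and the reflection degenerates to the identity, as needed.\<close>

lemma orthogonal_matrix_with_first_column:
  fixes v :: "real vec"
  assumes v: "v \<in> carrier_vec (Suc n)" and unit: "v \<bullet> v = 1"
  obtains H where "H \<in> carrier_mat (Suc n) (Suc n)" "H\<^sup>T = H" "H * H = 1\<^sub>m (Suc n)" "col H 0 = v"
proof -
  define w where "w = (\<lambda>i. v $ i - (if i = 0 then 1 else 0))"
  define s where "s = (\<Sum>i<Suc n. w i * w i)"
  define c where "c = 2 / s"
  define H where "H = mat (Suc n) (Suc n) (\<lambda>(i, j). (if i = j then 1 else 0) - c * w i * w j)"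
  have vv: "(\<Sum>i<Suc n. v $ i * v $ i) = 1"
    using unit v by (simp add: scalar_prod_def atLeast0LessThan del: sum.lessThan_Suc)
  \<comment> \<open>Because \<open>v\<close> has length one, the squared length \<open>s\<close> of
    \<open>w\<close> is \<open>- 2 * w 0\<close>. Hence \<open>c * w 0 = -1\<close> unless
    \<open>s = 0\<close>, and column 0 of \<open>H\<close> is the first unit vector plus
    \<open>w\<close>, which is \<open>v\<close>.\<close>
  have "s = (\<Sum>i<Suc n. v $ i * v $ i - (if i = 0 then 2 * v $ 0 - 1 else 0))"
    unfolding s_def w_def by (intro sum.cong refl) (auto simp: algebra_simps)
  also have "\<dots> = 2 - 2 * v $ 0"
    using vv by (simp add: sum_subtractf del: sum.lessThan_Suc)
  finally have s: "s = - 2 * w 0" by (simp add: w_def)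
  have cs: "c * c * s = 2 * c" unfolding c_def by (cases "s = 0") auto
  have zero: "w i = 0" if "s = 0" "i < Suc n" for i
  proof -
    have "\<forall>i\<in>{..<Suc n}. w i * w i = 0"
      using that(1) unfolding s_def by (subst (asm) sum_nonneg_eq_0_iff) auto
    then show ?thesis using that(2) by auto
  qed
  have cw: "c * w 0 * w i = - w i" if "i < Suc n" for i
    using zero[OF _ that] unfolding c_def by (cases "s = 0") (auto simp: s)
  have H: "H \<in> carrier_mat (Suc n) (Suc n)" unfolding H_def by simp
  have HH: "H * H = 1\<^sub>m (Suc n)"
  proof (rule eq_matI)
    fix i j assume "i < dim_row (1\<^sub>m (Suc n) :: real mat)" "j < dim_col (1\<^sub>m (Suc n) :: real mat)"
    then have ij: "i < Suc n" "j < Suc n" by auto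
    have "(H * H) $$ (i, j) = (\<Sum>k<Suc n. ((if i = k then 1 else 0) - c * w i * w k)
        * ((if k = j then 1 else 0) - c * w k * w j))"
      using ij unfolding H_def
      by (simp add: scalar_prod_def atLeast0LessThan del: sum.lessThan_Suc)
    also have "\<dots> = (\<Sum>k<Suc n. (if k = i then if i = j then 1 else 0 else 0)
        - (if k = i then c * w i * w j else 0) - (if k = j then c * w i * w j else 0)
        + c * c * w i * w j * (w k * w k))"
      by (intro sum.cong refl) (auto simp: algebra_simps)
    also have "\<dots> = (if i = j then 1 else 0) - 2 * (c * w i * w j) + c * c * w i * w j * s"
      using ij by (simp add: sum.distrib sum_subtractf sum_distrib_left[symmetric] s_def[symmetric]
          del: sum.lessThan_Suc)
    also have "\<dots> = (if i = j then 1 else 0) + (c * c * s - 2 * c) * (w i * w j)"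
      by (simp add: algebra_simps)
    finally show "(H * H) $$ (i, j) = 1\<^sub>m (Suc n) $$ (i, j)" using cs ij by simp
  qed (use H in auto)
  show ?thesis
  proof
    show "H\<^sup>T = H" unfolding H_def by (rule eq_matI) (auto simp: mult.assoc mult.commute)
    show "col H 0 = v"
    proof (rule eq_vecI)
      fix i assume "i < dim_vec v"
      then have i: "i < Suc n" using v by simp
      then have "col H 0 $ i = (if i = 0 then 1 else 0) - c * w 0 * w i" by (simp add: H_def)
      then show "col H 0 $ i = v $ i" using cw[OF i] by (simp add: w_def)
    qed (use v H in auto)
  qed (fact H HH)+
qed

text \<open>Deflation by induction on the size: a reflection \<open>H\<close> whose first column is
  a unit eigenvector turns \<open>A\<close> into \<open>H * A * H\<close>, which splits into the
  eigenvalue and a smaller symmetric block. The orthogonal factor of that block, bordered by 1 and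
  multiplied by \<open>H\<close>, diagonalises \<open>A\<close>.\<close>

theorem real_spectral_theorem:
  fixes A :: "real mat"
  assumes "A \<in> carrier_mat n n" "A\<^sup>T = A"
  obtains P B where "P \<in> carrier_mat n n" "B \<in> carrier_mat n n" "P * P\<^sup>T = 1\<^sub>m n"
    "P\<^sup>T * P = 1\<^sub>m n" "diagonal_mat B" "A = P * B * P\<^sup>T"
proof -
  have "\<exists>P B. P \<in> carrier_mat n n \<and> B \<in> carrier_mat n n \<and> P\<^sup>T * P = 1\<^sub>m n \<and> diagonal_mat B
      \<and> A = P * B * P\<^sup>T"
    using assms
  proof (induction n arbitrary: A)
    case 0
    then show ?case by (intro exI[of _ "1\<^sub>m 0"] exI[of _ A]) (auto simp: diagonal_mat_def)
  next
    case (Suc n)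
    note A = Suc.prems(1)
    obtain e v where v: "v \<in> carrier_vec (Suc n)" "v \<bullet> v = 1" "A *\<^sub>v v = e \<cdot>\<^sub>v v"
      using symmetric_unit_eigenvector_exists[OF Suc.prems] by blast
    obtain H where H: "H \<in> carrier_mat (Suc n) (Suc n)" "H\<^sup>T = H" "H * H = 1\<^sub>m (Suc n)" "col H 0 = v"
      using orthogonal_matrix_with_first_column[OF v(1,2)] by blast
    define C where "C = H * A * H"
    have C: "C \<in> carrier_mat (Suc n) (Suc n)" using A H unfolding C_def by simp
    have CT: "C\<^sup>T = C"
      using A H(1,2) Suc.prems(2) unfolding C_def
      by (simp add: transpose_mult[of _ "Suc n" "Suc n" _ "Suc n"] assoc_mult_mat[of _ "Suc n" "Suc n"])
    have symC: "C $$ (i, j) = C $$ (j, i)" if "i < Suc n" "j < Suc n" for i j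
      using C CT that by (metis carrier_matD index_transpose_mat(1))
    \<comment> \<open>\<open>H\<close> is an involution that sends the first unit vector to
      \<open>v\<close>, so it also sends \<open>v\<close> back. This makes column 0 of
      \<open>C\<close> a multiple of the first unit vector.\<close>
    have Hv: "H *\<^sub>v v = unit_vec (Suc n) 0"
      using col_mult2[OF H(1) H(1), of 0] H(3,4) by simp
    have "col C 0 = H *\<^sub>v (A *\<^sub>v v)"
      unfolding C_def assoc_mult_mat[OF H(1) A H(1)]
      using col_mult2[OF H(1) mult_carrier_mat[OF A H(1)], of 0] col_mult2[OF A H(1), of 0] H(4)
      by simp
    also have "\<dots> = e \<cdot>\<^sub>v unit_vec (Suc n) 0"
      using H(1) v by (simp add: mult_mat_vec Hv)
    finally have "col C 0 $ i = (if i = 0 then e else 0)" if "i < Suc n" for i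
      using that by simp
    then have C0: "C $$ (i, 0) = (if i = 0 then e else 0)" if "i < Suc n" for i
      using that C by simp
    have C1: "C $$ (0, Suc j) = 0" if "j < n" for j
      using symC[of 0 "Suc j"] C0[of "Suc j"] that by simp
    define A' where "A' = mat n n (\<lambda>(i, j). C $$ (Suc i, Suc j))"
    have A': "A' \<in> carrier_mat n n" "A'\<^sup>T = A'"
      unfolding A'_def using symC by (auto intro!: eq_matI)
    from Suc.IH[OF A'] obtain P' B' where P': "P' \<in> carrier_mat n n" "B' \<in> carrier_mat n n"
      "P'\<^sup>T * P' = 1\<^sub>m n" "diagonal_mat B'" "A' = P' * B' * P'\<^sup>T" by blast
    let ?E = "mat 1 1 (\<lambda>_. e)"
    let ?blk = "\<lambda>M N. four_block_mat M (0\<^sub>m 1 n) (0\<^sub>m n 1) N :: real mat"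
    have Cblk: "C = ?blk ?E A'"
      using C C0 C1 unfolding A'_def
      by (intro eq_matI) (auto simp: less_Suc_eq_0_disj)
    have mult: "?blk M N * ?blk M' N' = ?blk (M * M') (N * N')"
      if "M \<in> carrier_mat 1 1" "M' \<in> carrier_mat 1 1" "N \<in> carrier_mat n n" "N' \<in> carrier_mat n n"
      for M M' N N'
      using that by (subst mult_four_block_mat[of _ 1 1 _ n _ n _ _ 1 _ n]) auto
    let ?Q = "?blk (1\<^sub>m 1) P'" and ?B = "?blk ?E B'"
    have Q: "?Q \<in> carrier_mat (Suc n) (Suc n)" and B: "?B \<in> carrier_mat (Suc n) (Suc n)"
      using P' by (auto simp: four_block_carrier_mat[of _ 1 1 _ n n, simplified])
    have QT: "?Q\<^sup>T = ?blk (1\<^sub>m 1) (P'\<^sup>T)"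
      using P'(1) by (subst transpose_four_block_mat[of _ 1 1 _ n _ n]) auto
    have QQ: "?Q\<^sup>T * ?Q = 1\<^sub>m (Suc n)"
      unfolding QT using P' by (subst mult) (auto intro!: eq_matI)
    have "?Q * ?B = ?blk (1\<^sub>m 1 * ?E) (P' * B')" using P' by (intro mult) auto
    moreover have "?blk (1\<^sub>m 1 * ?E) (P' * B') * ?blk (1\<^sub>m 1) (P'\<^sup>T)
        = ?blk (1\<^sub>m 1 * ?E * 1\<^sub>m 1) (P' * B' * P'\<^sup>T)"
      using P' by (intro mult) auto
    moreover have "1\<^sub>m 1 * ?E * 1\<^sub>m 1 = ?E" by (metis left_mult_one_mat mat_carrier right_mult_one_mat)
    ultimately have CQ: "C = ?Q * ?B * ?Q\<^sup>T" unfolding QT Cblk P'(5) by simp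
    have dB: "diagonal_mat ?B"
      using P'(2,4) unfolding diagonal_mat_def by auto
    define P where "P = H * ?Q"
    have P: "P \<in> carrier_mat (Suc n) (Suc n)" unfolding P_def using H(1) Q by simp
    have PT: "P\<^sup>T = ?Q\<^sup>T * H"
      unfolding P_def using H(1,2) Q by (simp add: transpose_mult[of _ "Suc n" "Suc n" _ "Suc n"])
    have QTc: "?Q\<^sup>T \<in> carrier_mat (Suc n) (Suc n)" using Q by simp
    have "P\<^sup>T * P = ?Q\<^sup>T * (H * H) * ?Q"
      unfolding PT unfolding P_def using H(1) Q QTc by (simp add: assoc_mult_mat[of _ "Suc n" "Suc n" _ "Suc n" _ "Suc n"])
    then have PP: "P\<^sup>T * P = 1\<^sub>m (Suc n)" unfolding H(3) right_mult_one_mat[OF QTc] QQ .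
    have "A = (H * H) * A * (H * H)" using A H(3) by simp
    also have "\<dots> = H * C * H"
      unfolding C_def using A H(1) by (simp add: assoc_mult_mat[of _ "Suc n" "Suc n" _ "Suc n" _ "Suc n"])
    also have "\<dots> = P * ?B * P\<^sup>T"
      unfolding PT unfolding P_def CQ using H(1) Q QTc B
      by (simp add: assoc_mult_mat[of _ "Suc n" "Suc n" _ "Suc n" _ "Suc n"])
    finally show ?case using P B PP dB by blast
  qed
  then obtain P B where PB: "P \<in> carrier_mat n n" "B \<in> carrier_mat n n" "P\<^sup>T * P = 1\<^sub>m n"
    "diagonal_mat B" "A = P * B * P\<^sup>T" by blast
  then have "P * P\<^sup>T = 1\<^sub>m n" using mat_mult_left_right_inverse[of "P\<^sup>T" n P] by simp
  with PB that show thesis by blast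
qed

section \<open>Counting eigenvalues\<close>

text \<open>Gaussian elimination by induction on the equations: equation \<open>k\<close>, with a
  nonzero coefficient at \<open>p\<close>, removes the unknown \<open>p\<close> from the other
  equations, and \<open>z\<close> is the value at \<open>p\<close> that solves equation
  \<open>k\<close> itself.\<close>

lemma homogeneous_system_nontrivial_solution:
  fixes m :: "'k \<Rightarrow> 'i \<Rightarrow> 'f :: field"
  assumes "finite K" "finite I" "card K < card I"
  shows "\<exists>c. (\<exists>i\<in>I. c i \<noteq> 0) \<and> (\<forall>k\<in>K. (\<Sum>i\<in>I. m k i * c i) = 0)"
  using assms
proof (induction K arbitrary: I m rule: finite_induct)
  case empty
  then show ?case by (intro exI[of _ "\<lambda>_. 1"]) (auto simp: card_gt_0_iff)
next
  case (insert k K)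
  show ?case
  proof (cases "\<forall>i\<in>I. m k i = 0")
    case True
    then show ?thesis using insert.IH[of I m] insert.prems insert.hyps by auto
  next
    case False
    then obtain p where p: "p \<in> I" "m k p \<noteq> 0" by blast
    let ?I = "I - {p}"
    have card: "card K < card ?I" using insert.prems insert.hyps p(1) by simp
    obtain c where c: "\<exists>i\<in>?I. c i \<noteq> 0"
      "\<forall>l\<in>K. (\<Sum>i\<in>?I. (m l i - m l p * m k i / m k p) * c i) = 0"
      using insert.IH[OF _ card, of "\<lambda>l i. m l i - m l p * m k i / m k p"] insert.prems(1) by auto
    define z where "z = - (\<Sum>i\<in>?I. m k i * c i) / m k p"
    have split: "(\<Sum>i\<in>I. m l i * (c(p := z)) i) = m l p * z + (\<Sum>i\<in>?I. m l i * c i)" for l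
      using insert.prems(1) p(1) by (simp add: sum.remove[of I p])
    have "(\<Sum>i\<in>I. m l i * (c(p := z)) i) = 0" if "l \<in> K" for l
    proof -
      have "0 = (\<Sum>i\<in>?I. m l i * c i) - m l p / m k p * (\<Sum>i\<in>?I. m k i * c i)"
        using c(2) that by (simp add: left_diff_distrib sum_subtractf sum_distrib_left mult.assoc)
      then show ?thesis unfolding split by (simp add: z_def)
    qed
    moreover have "(\<Sum>i\<in>I. m k i * (c(p := z)) i) = 0"
      unfolding split using p(2) by (simp add: z_def)
    moreover have "\<exists>i\<in>I. (c(p := z)) i \<noteq> 0" using c(1) by auto
    ultimately show ?thesis by blast
  qed
qed

section \<open>Quadratic forms in an orthonormal eigenbasis\<close>

text \<open>The factorisation \<open>A = P * B * P\<^sup>T\<close> indexed by vertices instead of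
  matrix positions: \<open>b i\<close> plays the role of the \<open>i\<close>-th column of
  \<open>P\<close>, and \<open>orthonormal\<close> and \<open>complete\<close> say that
  \<open>P\<close> is orthogonal from either side.\<close>

locale orthonormal_eigenbasis =
  fixes V :: "'a set" and n :: nat and f :: "'a \<Rightarrow> 'a \<Rightarrow> real"
    and ev :: "nat \<Rightarrow> real" and b :: "nat \<Rightarrow> 'a \<Rightarrow> real"
  assumes finite_V: "finite V"
    and orthonormal: "\<lbrakk>i < n; j < n\<rbrakk> \<Longrightarrow> (\<Sum>u\<in>V. b i u * b j u) = (if i = j then 1 else 0)"
    and complete: "\<lbrakk>u \<in> V; w \<in> V\<rbrakk> \<Longrightarrow> (\<Sum>i<n. b i u * b i w) = (if u = w then 1 else 0)"
    and decomposition: "\<lbrakk>u \<in> V; w \<in> V\<rbrakk> \<Longrightarrow> f u w = (\<Sum>i<n. ev i * b i u * b i w)"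
begin

definition coord :: "('a \<Rightarrow> real) \<Rightarrow> nat \<Rightarrow> real" where
  "coord x i = (\<Sum>u\<in>V. x u * b i u)"

text \<open>Entries of \<open>f + s I\<close>, whose eigenvalues are \<open>ev i + s\<close>; the
  shifts 1 and 2 send the eigenvalues -1 and -2 to zero.\<close>

definition shifted :: "real \<Rightarrow> 'a \<Rightarrow> 'a \<Rightarrow> real" where
  "shifted s u w = f u w + (if u = w then s else 0)"

lemma shifted_eq:
  assumes "u \<in> V" "w \<in> V"
  shows "shifted s u w = (\<Sum>i<n. (ev i + s) * b i u * b i w)"
proof -
  have "(\<Sum>i<n. (ev i + s) * b i u * b i w)
      = (\<Sum>i<n. ev i * b i u * b i w) + s * (\<Sum>i<n. b i u * b i w)"
    by (simp add: sum_distrib_left sum.distrib algebra_simps)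
  then show ?thesis using assms by (simp add: shifted_def decomposition complete)
qed

lemma shifted_apply:
  assumes "u \<in> V"
  shows "(\<Sum>w\<in>V. shifted s u w * x w) = (\<Sum>i<n. (ev i + s) * coord x i * b i u)"
proof -
  have "(\<Sum>w\<in>V. shifted s u w * x w) = (\<Sum>w\<in>V. \<Sum>i<n. (ev i + s) * b i u * (x w * b i w))"
    using assms by (intro sum.cong refl) (simp add: shifted_eq sum_distrib_left sum_distrib_right mult_ac)
  also have "\<dots> = (\<Sum>i<n. \<Sum>w\<in>V. (ev i + s) * b i u * (x w * b i w))" by (rule sum.swap)
  also have "\<dots> = (\<Sum>i<n. (ev i + s) * b i u * coord x i)"
    by (simp add: coord_def sum_distrib_left)
  finally show ?thesis by (simp add: mult_ac)
qed

text \<open>The eigenbasis diagonalises the form, so its sign on a subspace can be traded for the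
  position of eigenvalues relative to \<open>- s\<close>.\<close>

lemma shifted_form:
  "(\<Sum>u\<in>V. \<Sum>w\<in>V. x u * x w * shifted s u w) = (\<Sum>i<n. (ev i + s) * (coord x i)\<^sup>2)"
proof -
  have "(\<Sum>u\<in>V. \<Sum>w\<in>V. x u * x w * shifted s u w)
      = (\<Sum>u\<in>V. x u * (\<Sum>w\<in>V. shifted s u w * x w))"
    by (simp add: sum_distrib_left mult_ac)
  also have "\<dots> = (\<Sum>u\<in>V. \<Sum>i<n. (ev i + s) * coord x i * (x u * b i u))"
    by (intro sum.cong refl) (simp add: shifted_apply, simp add: sum_distrib_left mult_ac)
  also have "\<dots> = (\<Sum>i<n. \<Sum>u\<in>V. (ev i + s) * coord x i * (x u * b i u))" by (rule sum.swap)
  also have "\<dots> = (\<Sum>i<n. (ev i + s) * (coord x i)\<^sup>2)"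
    by (simp add: sum_distrib_left[symmetric] coord_def[symmetric] power2_eq_square mult.assoc)
  finally show ?thesis .
qed

lemma coord_combination:
  assumes "I \<subseteq> {..<n}" "j < n"
  shows "coord (\<lambda>u. \<Sum>i\<in>I. c i * b i u) j = (if j \<in> I then c j else 0)"
proof -
  have I: "finite I" using assms(1) finite_subset by blast
  have "coord (\<lambda>u. \<Sum>i\<in>I. c i * b i u) j = (\<Sum>u\<in>V. \<Sum>i\<in>I. c i * (b i u * b j u))"
    by (simp add: coord_def sum_distrib_left sum_distrib_right mult_ac)
  also have "\<dots> = (\<Sum>i\<in>I. c i * (\<Sum>u\<in>V. b i u * b j u))"
    by (subst sum.swap) (simp add: sum_distrib_left)
  also have "\<dots> = (\<Sum>i\<in>I. if i = j then c j else 0)"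
    using assms by (intro sum.cong refl) (auto simp: orthonormal)
  finally show ?thesis using I by simp
qed

text \<open>A labelling \<open>g\<close> of \<open>S\<close> encodes the subspace of vectors supported on \<open>S\<close> and constant on each label
  class; its dimension is \<open>card (g ` S)\<close>.\<close>

lemma card_eigenvalues_greater:
  fixes g :: "'a \<Rightarrow> 'l"
  assumes S: "S \<subseteq> V"
    and pos: "\<And>c. (\<exists>l\<in>g ` S. c l \<noteq> 0) \<Longrightarrow>
      (\<Sum>u\<in>S. \<Sum>w\<in>S. c (g u) * c (g w) * shifted s u w) > 0"
  shows "card (g ` S) \<le> card {i \<in> {..<n}. ev i > - s}"
proof (rule ccontr)
  let ?P = "{i \<in> {..<n}. ev i > - s}"
  have fS: "finite S" using S finite_V finite_subset by blast
  assume "\<not> card (g ` S) \<le> card ?P"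
  \<comment> \<open>The unknowns are the label values, and the equations demand orthogonality to
    every \<open>b i\<close> with \<open>ev i > - s\<close>. Fewer equations than labels leave a
    nonzero vector on which only nonpositive terms of the form survive.\<close>
  then obtain c where c: "\<exists>l\<in>g ` S. c l \<noteq> 0"
    "\<forall>i\<in>?P. (\<Sum>l\<in>g ` S. (\<Sum>u\<in>{u\<in>S. g u = l}. b i u) * c l) = 0"
    using homogeneous_system_nontrivial_solution[of ?P "g ` S" "\<lambda>i l. \<Sum>u\<in>{u\<in>S. g u = l}. b i u"]
      fS by auto
  define x where "x = (\<lambda>u. if u \<in> S then c (g u) else 0)"
  have restrict: "(\<Sum>u\<in>V. x u * h u) = (\<Sum>u\<in>S. c (g u) * h u)" for h
    unfolding x_def using S finite_V by (auto intro!: sum.mono_neutral_cong_right)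
  have zero: "coord x i = 0" if "i \<in> ?P" for i
  proof -
    have "coord x i = (\<Sum>l\<in>g ` S. \<Sum>u\<in>{u\<in>S. g u = l}. c (g u) * b i u)"
      unfolding coord_def restrict by (rule sum.image_gen[OF fS])
    also have "\<dots> = (\<Sum>l\<in>g ` S. (\<Sum>u\<in>{u\<in>S. g u = l}. b i u) * c l)"
      by (intro sum.cong refl) (simp add: sum_distrib_left sum_distrib_right mult.commute)
    finally show ?thesis using c(2) that by simp
  qed
  have "(\<Sum>u\<in>S. \<Sum>w\<in>S. c (g u) * c (g w) * shifted s u w)
      = (\<Sum>u\<in>V. x u * (\<Sum>w\<in>V. x w * shifted s u w))"
    unfolding restrict by (simp add: sum_distrib_left mult_ac)
  also have "\<dots> = (\<Sum>i<n. (ev i + s) * (coord x i)\<^sup>2)"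
    unfolding shifted_form[symmetric] by (simp add: sum_distrib_left mult_ac)
  also have "\<dots> \<le> 0"
  proof (rule sum_nonpos)
    fix i assume "i \<in> {..<n}"
    then show "(ev i + s) * (coord x i)\<^sup>2 \<le> 0"
      using zero[of i] by (cases "ev i > - s") (auto simp: mult_nonpos_nonneg)
  qed
  finally show False using pos[OF c(1)] by simp
qed

text \<open>With more exceptional eigenvectors than sets in \<open>K\<close>, some nonzero
  combination of them sums to zero on every set in \<open>K\<close>. The product of the two shifted
  matrices kills it, yet multiplies its \<open>j\<close>-th coordinate by the nonzero number
  \<open>(ev j + s) * (ev j + t)\<close>.\<close>

lemma card_exceptional_eigenvalues_le:
  assumes K: "finite K" "\<And>C. C \<in> K \<Longrightarrow> C \<subseteq> V"
    and kill: "\<And>x u. \<lbrakk>\<And>C. C \<in> K \<Longrightarrow> (\<Sum>w\<in>C. x w) = 0; u \<in> V\<rbrakk> \<Longrightarrow>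
      (\<Sum>w\<in>V. shifted s u w * (\<Sum>z\<in>V. shifted t w z * x z)) = 0"
  shows "card {i \<in> {..<n}. ev i \<noteq> - s \<and> ev i \<noteq> - t} \<le> card K"
proof (rule ccontr)
  let ?E = "{i \<in> {..<n}. ev i \<noteq> - s \<and> ev i \<noteq> - t}"
  assume "\<not> card ?E \<le> card K"
  then obtain c where c: "\<exists>i\<in>?E. c i \<noteq> 0" "\<forall>C\<in>K. (\<Sum>i\<in>?E. (\<Sum>u\<in>C. b i u) * c i) = 0"
    using homogeneous_system_nontrivial_solution[of K ?E "\<lambda>C i. \<Sum>u\<in>C. b i u"] K(1) by auto
  define x where "x = (\<lambda>u. \<Sum>i\<in>?E. c i * b i u)"
  define y where "y = (\<lambda>w. \<Sum>z\<in>V. shifted t w z * x z)"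
  have x: "coord x i = (if i \<in> ?E then c i else 0)" if "i < n" for i
    unfolding x_def using that by (intro coord_combination) auto
  have "(\<Sum>u\<in>C. x u) = 0" if "C \<in> K" for C
  proof -
    have "(\<Sum>u\<in>C. x u) = (\<Sum>i\<in>?E. (\<Sum>u\<in>C. b i u) * c i)"
      unfolding x_def by (subst sum.swap) (simp add: sum_distrib_left mult.commute)
    then show ?thesis using c(2) that by simp
  qed
  then have y0: "(\<Sum>w\<in>V. shifted s u w * y w) = 0" if "u \<in> V" for u
    unfolding y_def using kill that by blast
  obtain j where j: "j \<in> ?E" "c j \<noteq> 0" using c(1) by blast
  have coord_op: "coord (\<lambda>u. \<Sum>w\<in>V. shifted r u w * h w) j = (ev j + r) * coord h j" for r h
  proof -
    have "coord (\<lambda>u. \<Sum>w\<in>V. shifted r u w * h w) j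
        = coord (\<lambda>u. \<Sum>i<n. (ev i + r) * coord h i * b i u) j"
      unfolding coord_def[of _ j] by (intro sum.cong refl) (simp add: shifted_apply)
    then show ?thesis using j coord_combination[of "{..<n}" j] by auto
  qed
  have "coord (\<lambda>u. \<Sum>w\<in>V. shifted s u w * y w) j = 0"
    unfolding coord_def using y0 by simp
  then have "(ev j + s) * ((ev j + t) * coord x j) = 0"
    unfolding coord_op y_def .
  then show False using x[of j] j by auto
qed

text \<open>The shifted form is positive semidefinite, so a nonpositive value makes each of its
  diagonal terms vanish, and with them each coordinate of the image of \<open>x\<close>.\<close>

lemma isotropic_imp_kernel:
  assumes ge: "\<And>i. i < n \<Longrightarrow> ev i \<ge> - s"
    and form: "(\<Sum>u\<in>V. \<Sum>w\<in>V. x u * x w * shifted s u w) \<le> 0" and u: "u \<in> V"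
  shows "(\<Sum>w\<in>V. shifted s u w * x w) = 0"
proof -
  have nn: "(ev i + s) * (coord x i)\<^sup>2 \<ge> 0" if "i < n" for i using ge[OF that] by simp
  then have "(\<Sum>i<n. (ev i + s) * (coord x i)\<^sup>2) = 0"
    using form unfolding shifted_form by (meson antisym lessThan_iff sum_nonneg)
  then have "(ev i + s) * (coord x i)\<^sup>2 = 0" if "i < n" for i
    using nn that by (subst (asm) sum_nonneg_eq_0_iff) auto
  then have "(ev i + s) * coord x i = 0" if "i < n" for i using that by auto
  then show ?thesis unfolding shifted_apply[OF u] by (intro sum.neutral) simp
qed

end

section \<open>From matrices to eigenbases, and multiplicities as counts\<close>

text \<open>The spectral theorem read through the enumeration \<open>vs\<close>: \<open>pos\<close>
  inverts it, so columns of \<open>P\<close> become functions on the vertices. Similarity to the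
  diagonal matrix \<open>B\<close> makes the same numbers \<open>ev i\<close> the roots of the
  characteristic polynomial.\<close>

lemma orthonormal_eigenbasis_exists:
  fixes f :: "'a \<Rightarrow> 'a \<Rightarrow> real"
  assumes vs: "distinct vs" and sym: "\<And>u w. \<lbrakk>u \<in> set vs; w \<in> set vs\<rbrakk> \<Longrightarrow> f u w = f w u"
  defines "A \<equiv> mat (length vs) (length vs) (\<lambda>(i, j). f (vs ! i) (vs ! j))"
  obtains ev b where "orthonormal_eigenbasis (set vs) (length vs) f ev b"
    "char_poly A = (\<Prod>i<length vs. [:- ev i, 1:])"
proof -
  define n where "n = length vs"
  have A: "A \<in> carrier_mat n n" unfolding A_def n_def by simp
  have "A\<^sup>T = A" unfolding A_def by (rule eq_matI) (auto intro: sym)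
  with A obtain P B where PB: "P \<in> carrier_mat n n" "B \<in> carrier_mat n n" "P * P\<^sup>T = 1\<^sub>m n"
    "P\<^sup>T * P = 1\<^sub>m n" "diagonal_mat B" "A = P * B * P\<^sup>T"
    by (rule real_spectral_theorem)
  define pos where "pos = the_inv_into {..<n} ((!) vs)"
  have bij: "bij_betw ((!) vs) {..<n} (set vs)"
    unfolding n_def using vs by (simp add: bij_betw_nth)
  have pos: "pos (vs ! k) = k" if "k < n" for k
    unfolding pos_def using bij that by (auto intro!: the_inv_into_f_f simp: bij_betw_def)
  define ev where "ev = (\<lambda>i. B $$ (i, i))"
  define b where "b = (\<lambda>i u. P $$ (pos u, i))"
  have b: "b i (vs ! k) = P $$ (k, i)" if "k < n" for i k unfolding b_def by (simp add: pos that)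
  have nth: "\<exists>k<n. u = vs ! k" if "u \<in> set vs" for u
    using that unfolding n_def by (metis in_set_conv_nth)
  have "orthonormal_eigenbasis (set vs) n f ev b"
  proof
    fix i j assume ij: "i < n" "j < n"
    have "(\<Sum>u\<in>set vs. b i u * b j u) = (\<Sum>k<n. P $$ (k, i) * P $$ (k, j))"
      unfolding sum.reindex_bij_betw[OF bij, symmetric] by (simp add: b)
    also have "\<dots> = (P\<^sup>T * P) $$ (i, j)"
      using PB(1) ij by (simp add: scalar_prod_def atLeast0LessThan)
    finally show "(\<Sum>u\<in>set vs. b i u * b j u) = (if i = j then 1 else 0)"
      unfolding PB(4) using ij by simp
  next
    fix u w assume "u \<in> set vs" "w \<in> set vs"
    then obtain k l where kl: "k < n" "u = vs ! k" "l < n" "w = vs ! l" using nth by meson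
    have "(\<Sum>i<n. b i u * b i w) = (P * P\<^sup>T) $$ (k, l)"
      using PB(1) kl by (simp add: b scalar_prod_def atLeast0LessThan)
    then show "(\<Sum>i<n. b i u * b i w) = (if u = w then 1 else 0)"
      unfolding PB(3) using kl vs by (simp add: nth_eq_iff_index_eq n_def)
    have PBij: "(P * B) $$ (k, i) = P $$ (k, i) * ev i" if "i < n" for i
    proof -
      have "(P * B) $$ (k, i) = (\<Sum>j<n. P $$ (k, j) * B $$ (j, i))"
        using PB(1,2) kl that by (simp add: scalar_prod_def atLeast0LessThan)
      also have "\<dots> = (\<Sum>j<n. if j = i then P $$ (k, i) * ev i else 0)"
        using PB(2,5) that by (intro sum.cong refl) (auto simp: diagonal_mat_def ev_def)
      finally show ?thesis using that by simp
    qed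
    have entry: "(M * P\<^sup>T) $$ (k, l) = (\<Sum>i<n. M $$ (k, i) * P $$ (l, i))"
      if "M \<in> carrier_mat n n" for M
      using PB(1) that kl by (simp add: scalar_prod_def atLeast0LessThan)
    have "f u w = A $$ (k, l)" unfolding A_def using kl by (simp add: n_def)
    also have "\<dots> = (\<Sum>i<n. (P * B) $$ (k, i) * P $$ (l, i))"
      unfolding PB(6) by (rule entry[OF mult_carrier_mat[OF PB(1,2)]])
    also have "\<dots> = (\<Sum>i<n. ev i * b i u * b i w)"
      using kl by (intro sum.cong refl) (simp add: PBij b)
    finally show "f u w = (\<Sum>i<n. ev i * b i u * b i w)" .
  qed simp
  moreover have "char_poly A = (\<Prod>i<n. [:- ev i, 1:])"
  proof -
    have "similar_mat A B"
      using PB A by (intro similar_matI[where P = P and Q = "P\<^sup>T" and n = n]) auto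
    then have "char_poly A = char_poly B" by (rule char_poly_similar)
    also have "\<dots> = (\<Prod>a\<leftarrow>diag_mat B. [:- a, 1:])"
      using PB(2,5) by (intro char_poly_upper_triangular) (auto simp: diagonal_mat_def upper_triangular_def)
    also have "\<dots> = (\<Prod>i<n. [:- ev i, 1:])"
      using PB(2) by (simp add: diag_mat_def ev_def o_def prod.list_conv_set_nth atLeast0LessThan)
    finally show ?thesis .
  qed
  ultimately show thesis using that unfolding n_def by blast
qed

text \<open>Orders add up over products. This turns the algebraic multiplicity of an eigenvalue into
  a number of indices of the eigenbasis.\<close>

lemma order_prod_linear_factors:
  fixes a :: "'b \<Rightarrow> 'f :: idom"
  assumes "finite I"
  shows "order c (\<Prod>i\<in>I. [:- a i, 1:]) = card {i \<in> I. a i = c}"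
  using assms
proof (induction I rule: finite_induct)
  case empty
  then show ?case by (simp add: order_0I)
next
  case (insert j I)
  have nz: "(\<Prod>i\<in>I. [:- a i, 1:]) \<noteq> 0" using insert.hyps(1) by simp
  have lin: "order c [:- a j, 1:] = (if a j = c then 1 else 0)"
    by (cases "a j = c") (auto simp: order_0I order_linear)
  have "{i \<in> insert j I. a i = c} = (if a j = c then insert j {i \<in> I. a i = c} else {i \<in> I. a i = c})"
    by auto
  moreover have "order c ([:- a j, 1:] * (\<Prod>i\<in>I. [:- a i, 1:]))
      = order c [:- a j, 1:] + order c (\<Prod>i\<in>I. [:- a i, 1:])"
    using nz by (intro order_mult) (simp only: mult_eq_0_iff, simp)
  ultimately show ?case
    using insert.hyps insert.IH unfolding lin prod.insert[OF insert.hyps] by simp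
qed

section \<open>Eigenvalues of the distance matrix\<close>

context pair_graph
begin

lemma arc_commute: "(u, v) \<in> parcs G \<longleftrightarrow> (v, u) \<in> parcs G"
  by (auto intro: arcs_symmetric)

lemma arc_neq: "(u, v) \<in> parcs G \<Longrightarrow> u \<noteq> v"
  using pair_no_loops by fastforce

lemma apath_rev_path: "apath u p v \<Longrightarrow> apath v (rev_path p) u"
  unfolding apath_def using awalk_verts_rev_path by auto

lemma length_rev_path: "length (rev_path p) = length p"
  by (induction p) auto

lemma graph_dist_commute: "graph_dist G u v = graph_dist G v u"
proof -
  have "(\<exists>p. apath u p v \<and> length p = k) \<longleftrightarrow> (\<exists>p. apath v p u \<and> length p = k)" for k
    using apath_rev_path length_rev_path by metis
  then show ?thesis unfolding graph_dist_def by simp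
qed

lemma graph_dist_le: "apath u p v \<Longrightarrow> graph_dist G u v \<le> length p"
  unfolding graph_dist_def by (rule Least_le) blast

end

locale connected_pair_graph = pair_graph +
  assumes connected: "Digraph_Component.connected (with_proj G)"
begin

lemma reachable: "\<lbrakk>u \<in> pverts G; v \<in> pverts G\<rbrakk> \<Longrightarrow> u \<rightarrow>\<^sup>*\<^bsub>G\<^esub> v"
  using symmetric_connected_imp_strongly_connected[OF sym_arcs connected]
  by (auto simp: strongly_connected_def)

lemma shortest_apath:
  assumes "u \<in> pverts G" "v \<in> pverts G"
  obtains p where "apath u p v" "length p = graph_dist G u v"
proof -
  have "\<exists>k p. apath u p v \<and> length p = k" using reachable[OF assms] reachable_apath by auto
  from LeastI_ex[OF this] that show thesis unfolding graph_dist_def by blast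
qed

lemma graph_dist_eq_0_iff:
  assumes "u \<in> pverts G" "v \<in> pverts G"
  shows "graph_dist G u v = 0 \<longleftrightarrow> u = v"
proof
  assume "graph_dist G u v = 0"
  with shortest_apath[OF assms] show "u = v" by (metis apath_Nil_iff length_0_conv)
next
  assume "u = v"
  then show "graph_dist G u v = 0" using graph_dist_le[of u "[]" v] assms by (simp add: apath_Nil_iff)
qed

lemma graph_dist_eq_1_iff:
  assumes "u \<in> pverts G" "v \<in> pverts G"
  shows "graph_dist G u v = 1 \<longleftrightarrow> (u, v) \<in> parcs G"
proof
  assume 1: "graph_dist G u v = 1"
  obtain p where "apath u p v" "length p = 1" using shortest_apath[OF assms] 1 by metis
  then obtain e where "apath u [e] v" by (cases p) auto
  then show "(u, v) \<in> parcs G" by (cases e) (auto simp: apath_simps)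
next
  assume uv: "(u, v) \<in> parcs G"
  then have "apath u [(u, v)] v" using arc_neq assms by (auto simp: apath_simps)
  from graph_dist_le[OF this] graph_dist_eq_0_iff[OF assms] arc_neq[OF uv]
  show "graph_dist G u v = 1" by simp
qed

lemma graph_dist_eq_2:
  assumes "(u, w) \<in> parcs G" "(w, v) \<in> parcs G" "u \<noteq> v" "(u, v) \<notin> parcs G"
  shows "graph_dist G u v = 2"
proof -
  have V: "u \<in> pverts G" "v \<in> pverts G" using assms by (auto dest: wellformed')
  have "apath u [(u, w), (w, v)] v" using assms arc_neq V by (auto simp: apath_simps)
  from graph_dist_le[OF this] have "graph_dist G u v \<le> 2" by simp
  moreover have "graph_dist G u v \<noteq> 0" "graph_dist G u v \<noteq> 1"
    using graph_dist_eq_0_iff[OF V] graph_dist_eq_1_iff[OF V] assms by auto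
  ultimately show ?thesis by simp
qed

text \<open>Without an induced path on three vertices, "equal or adjacent" is transitive. By
  connectedness every vertex would then be equal or adjacent to \<open>u\<close>, including
  \<open>w\<close>.\<close>

lemma induced_path_exists:
  assumes "u \<in> pverts G" "w \<in> pverts G" "u \<noteq> w" "(u, w) \<notin> parcs G"
  shows "\<exists>x y z. (x, y) \<in> parcs G \<and> (y, z) \<in> parcs G \<and> x \<noteq> z \<and> (x, z) \<notin> parcs G"
proof (rule ccontr)
  assume no: "\<not> ?thesis"
  then have trans: "x = z \<or> (x, z) \<in> parcs G" if "(x, y) \<in> parcs G" "(y, z) \<in> parcs G" for x y z
    using that no by blast
  have "u = v \<or> (u, v) \<in> parcs G" if "u \<rightarrow>\<^sup>*\<^bsub>G\<^esub> v" for v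
    using that by (induction rule: reachable_induct) (auto dest: trans)
  then show False using reachable assms by blast
qed

end

section \<open>Eigenvalue bounds from induced subgraphs\<close>

locale distance_eigenbasis = connected_pair_graph +
  orthonormal_eigenbasis "pverts G" n "\<lambda>u w. real (graph_dist G u w)" ev b for n ev b
begin

abbreviation exceptional :: "nat set" where
  "exceptional \<equiv> {i \<in> {..<n}. ev i \<noteq> - 1 \<and> ev i \<noteq> - 2}"

lemma shifted_self: "u \<in> pverts G \<Longrightarrow> shifted s u u = s"
  using graph_dist_eq_0_iff[of u u] by (simp add: shifted_def)

lemma shifted_arc: "(u, w) \<in> parcs G \<Longrightarrow> shifted s u w = 1"
  using graph_dist_eq_1_iff[of u w] arc_neq[of u w] by (auto simp: shifted_def dest: wellformed')

lemma shifted_two: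
  "\<lbrakk>(u, v) \<in> parcs G; (v, w) \<in> parcs G; u \<noteq> w; (u, w) \<notin> parcs G\<rbrakk> \<Longrightarrow> shifted s u w = 2"
  using graph_dist_eq_2[of u v w] by (simp add: shifted_def)

text \<open>The labels single out the middle vertex \<open>v\<close>, so the test vectors take one
  common value at the two ends of the induced path. On this plane the form of \<open>D + I\<close>
  is a sum of squares that vanishes only at zero.\<close>

lemma two_eigenvalues_greater:
  assumes "(u, v) \<in> parcs G" "(v, w) \<in> parcs G" "u \<noteq> w" "(u, w) \<notin> parcs G"
  shows "2 \<le> card {i \<in> {..<n}. ev i > - 1}"
proof -
  let ?g = "\<lambda>z. z = v"
  have V: "u \<in> pverts G" "v \<in> pverts G" "w \<in> pverts G" using assms by (auto dest: wellformed')
  have arcs: "(v, u) \<in> parcs G" "(w, v) \<in> parcs G" "(w, u) \<notin> parcs G"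
    using assms arc_commute by blast+
  have ne: "u \<noteq> v" "v \<noteq> w" using assms arc_neq by auto
  have sh: "shifted 1 u w = 2" "shifted 1 w u = 2"
    using shifted_two[OF assms] shifted_two[OF arcs(2,1)] assms(3) arcs(3) by auto
  have "card (?g ` {u, v, w}) \<le> card {i \<in> {..<n}. ev i > - 1}"
  proof (rule card_eigenvalues_greater)
    fix c :: "bool \<Rightarrow> real" assume "\<exists>l\<in>?g ` {u, v, w}. c l \<noteq> 0"
    then have nz: "c True \<noteq> 0 \<or> c False \<noteq> 0" using ne by auto
    have "(\<Sum>x\<in>{u, v, w}. \<Sum>y\<in>{u, v, w}. c (?g x) * c (?g y) * shifted 1 x y)
        = (2 * c False + c True)\<^sup>2 + 2 * (c False)\<^sup>2"
      using ne ne[symmetric] assms(3) assms(3)[symmetric] V assms(1,2) arcs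
      by (simp add: shifted_self shifted_arc sh) (simp add: power2_eq_square algebra_simps)
    also have "\<dots> > 0"
    proof (cases "c False = 0")
      case True
      then show ?thesis using nz by simp
    next
      case False
      then show ?thesis by (simp add: add_nonneg_pos)
    qed
    finally show "(\<Sum>x\<in>{u, v, w}. \<Sum>y\<in>{u, v, w}. c (?g x) * c (?g y) * shifted 1 x y) > 0" .
  qed (use V in auto)
  moreover have "?g ` {u, v, w} = {True, False}" using ne by auto
  ultimately show ?thesis by simp
qed

text \<open>The five vertices induce \<open>K_{1,2,2}\<close> with classes \<open>{w}\<close>,
  \<open>{u, u'}\<close> and \<open>{v, v'}\<close>. Vectors constant on these classes form a space
  of dimension three on which \<open>D + I\<close> is positive definite, again by completing the
  square.\<close>

lemma three_eigenvalues_greater: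
  assumes "(u, v) \<in> parcs G" "(u, v') \<in> parcs G" "(u', v) \<in> parcs G" "(u', v') \<in> parcs G"
    and "(u, w) \<in> parcs G" "(u', w) \<in> parcs G" "(v, w) \<in> parcs G" "(v', w) \<in> parcs G"
    and "u \<noteq> u'" "(u, u') \<notin> parcs G" "v \<noteq> v'" "(v, v') \<notin> parcs G"
  shows "3 \<le> card {i \<in> {..<n}. ev i > - 1}"
proof -
  let ?S = "{u, u', v, v', w}"
  let ?g = "\<lambda>z. if z = w then 0 else if z = u \<or> z = u' then 1 else 2 :: nat"
  have V: "u \<in> pverts G" "u' \<in> pverts G" "v \<in> pverts G" "v' \<in> pverts G" "w \<in> pverts G"
    using assms by (auto dest: wellformed')
  have arcs: "(v, u) \<in> parcs G" "(v', u) \<in> parcs G" "(v, u') \<in> parcs G" "(v', u') \<in> parcs G"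
    "(w, u) \<in> parcs G" "(w, u') \<in> parcs G" "(w, v) \<in> parcs G" "(w, v') \<in> parcs G"
    "(u', u) \<notin> parcs G" "(v', v) \<notin> parcs G"
    using assms arc_commute by blast+
  have ne: "u \<noteq> u'" "v \<noteq> v'" "u \<noteq> v" "u \<noteq> v'" "u' \<noteq> v" "u' \<noteq> v'"
    "u \<noteq> w" "u' \<noteq> w" "v \<noteq> w" "v' \<noteq> w"
    using assms arc_neq by auto
  have sh: "shifted 1 u u' = 2" "shifted 1 u' u = 2" "shifted 1 v v' = 2" "shifted 1 v' v = 2"
    using shifted_two[of u w u'] shifted_two[of u' w u] shifted_two[of v w v'] shifted_two[of v' w v]
      assms arcs ne by auto
  have "card (?g ` ?S) \<le> card {i \<in> {..<n}. ev i > - 1}"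
  proof (rule card_eigenvalues_greater)
    fix c :: "nat \<Rightarrow> real" assume "\<exists>l\<in>?g ` ?S. c l \<noteq> 0"
    then have nz: "c 0 \<noteq> 0 \<or> c 1 \<noteq> 0 \<or> c 2 \<noteq> 0" by (auto split: if_splits)
    have "(\<Sum>x\<in>?S. \<Sum>y\<in>?S. c (?g x) * c (?g y) * shifted 1 x y)
        = (2 * c 1 + 2 * c 2 + c 0)\<^sup>2 + 2 * (c 1)\<^sup>2 + 2 * (c 2)\<^sup>2"
      using ne ne[symmetric] V assms(1-8) arcs(1-8)
      by (simp add: shifted_self shifted_arc sh) (simp add: power2_eq_square algebra_simps)
    also have "\<dots> > 0"
    proof (cases "c 1 = 0 \<and> c 2 = 0")
      case True
      then show ?thesis using nz by simp
    next
      case False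
      then have "2 * (c 1)\<^sup>2 + 2 * (c 2)\<^sup>2 > 0" using sum_power2_gt_zero_iff[of "c 1" "c 2"] by simp
      then show ?thesis using zero_le_power2[of "2 * c 1 + 2 * c 2 + c 0"] by linarith
    qed
    finally show "(\<Sum>x\<in>?S. \<Sum>y\<in>?S. c (?g x) * c (?g y) * shifted 1 x y) > 0" .
  qed (use V in auto)
  moreover have "?g ` ?S = {0, 1, 2}" using ne by auto
  ultimately show ?thesis by simp
qed

text \<open>Here \<open>D + I\<close> is the all-ones matrix. On vectors with sum zero,
  \<open>D + 2I\<close> acts as the identity and \<open>D + I\<close> as zero, so a single linear
  condition suffices. A graph with two exceptional eigenvalues is therefore not complete.\<close>

lemma complete_imp_card_exceptional_le_1:
  assumes "\<And>u w. \<lbrakk>u \<in> pverts G; w \<in> pverts G; u \<noteq> w\<rbrakk> \<Longrightarrow> (u, w) \<in> parcs G"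
  shows "card exceptional \<le> 1"
proof -
  have sh: "shifted s u w = (if u = w then s else 1)" if "u \<in> pverts G" "w \<in> pverts G" for s u w
    using that assms by (auto simp: shifted_self shifted_arc)
  have "card exceptional \<le> card {pverts G}"
  proof (rule card_exceptional_eigenvalues_le)
    fix x :: "'a \<Rightarrow> real" and u
    assume x: "\<And>C. C \<in> {pverts G} \<Longrightarrow> (\<Sum>w\<in>C. x w) = 0" and u: "u \<in> pverts G"
    have "(\<Sum>z\<in>pverts G. shifted 2 w z * x z) = x w" if "w \<in> pverts G" for w
    proof -
      have "(\<Sum>z\<in>pverts G. shifted 2 w z * x z) = (\<Sum>z\<in>pverts G. x z + (if w = z then x z else 0))"
        using that by (intro sum.cong refl) (simp add: sh)
      then show ?thesis using x that finite_V by (simp add: sum.distrib)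
    qed
    then have "(\<Sum>w\<in>pverts G. shifted 1 u w * (\<Sum>z\<in>pverts G. shifted 2 w z * x z))
        = (\<Sum>w\<in>pverts G. x w)"
      using u by (intro sum.cong refl) (simp add: sh)
    then show "(\<Sum>w\<in>pverts G. shifted 1 u w * (\<Sum>z\<in>pverts G. shifted 2 w z * x z)) = 0"
      using x by simp
  qed auto
  then show ?thesis by simp
qed

end

section \<open>The two families described by a vertex class\<close>

text \<open>One class \<open>C\<close> describes the graph from inside, without an isomorphism to a
  model. Bounds on the size of \<open>C\<close> are stated separately where they are needed.\<close>

definition complete_bipartition :: "'a pair_pre_digraph \<Rightarrow> 'a set \<Rightarrow> bool" where
  "complete_bipartition G C \<longleftrightarrow> C \<subseteq> pverts G \<and>
     (\<forall>u\<in>pverts G. \<forall>w\<in>pverts G. (u, w) \<in> parcs G \<longleftrightarrow> (u \<in> C) \<noteq> (w \<in> C))"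

text \<open>The join of the edgeless graph on \<open>C\<close> with the complete graph on the
  remaining vertices.\<close>

definition complete_split :: "'a pair_pre_digraph \<Rightarrow> 'a set \<Rightarrow> bool" where
  "complete_split G C \<longleftrightarrow> C \<subseteq> pverts G \<and>
     (\<forall>u\<in>pverts G. \<forall>w\<in>pverts G. (u, w) \<in> parcs G \<longleftrightarrow> u \<noteq> w \<and> \<not> (u \<in> C \<and> w \<in> C))"

context distance_eigenbasis
begin

lemma sum_split: "C \<subseteq> pverts G \<Longrightarrow> (\<Sum>u\<in>pverts G. h u) = (\<Sum>u\<in>C. h u) + (\<Sum>u\<in>pverts G - C. h u)"
  using finite_V by (metis add.commute sum.subset_diff)

text \<open>Two vertices of \<open>C\<close> and one outside form an induced path, which gives the
  lower bound. For the upper bound the linear conditions are zero sums on \<open>C\<close> and on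
  its complement: \<open>D + 2I\<close> kills such vectors in the bipartite case, and in the split
  case it leaves only their part outside \<open>C\<close>, which \<open>D + I\<close> kills.\<close>

lemma card_exceptional_eq_2I:
  assumes C: "complete_bipartition G C \<or> complete_split G C" "2 \<le> card C" "C \<noteq> pverts G"
  shows "card exceptional = 2"
proof (rule antisym)
  let ?V = "pverts G" and ?D = "pverts G - C"
  have CV: "C \<subseteq> ?V" using C(1) by (auto simp: complete_bipartition_def complete_split_def)
  obtain u w where uw: "u \<in> C" "w \<in> C" "u \<noteq> w"
    using C(2) by (auto simp: numeral_2_eq_2 card_le_Suc_iff)
  obtain v where v: "v \<in> ?D" using C(3) CV by blast
  have cross: "(x, y) \<in> parcs G" "(y, x) \<in> parcs G" if "x \<in> C" "y \<in> ?D" for x y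
    using C(1) CV that by (auto simp: complete_bipartition_def complete_split_def)
  have inC: "(x, y) \<notin> parcs G" if "x \<in> C" "y \<in> C" for x y
    using C(1) CV that by (auto simp: complete_bipartition_def complete_split_def)
  \<comment> \<open>Off the diagonal the entry is the distance 2 through \<open>v\<close>, on the
    diagonal it is the shift 2; so the block on \<open>C\<close> is constant.\<close>
  have shC: "shifted 2 x y = 2" if "x \<in> C" "y \<in> C" for x y
    using shifted_two[of x v y] shifted_self[of x 2] cross v inC that CV by (cases "x = y") auto
  have sh1: "shifted s x y = 1" "shifted s y x = 1" if "x \<in> C" "y \<in> ?D" for s x y
    using cross that shifted_arc by auto
  have "2 \<le> card {i \<in> {..<n}. ev i > - 1}"
    using two_eigenvalues_greater[of u v w] uw v cross inC by blast
  also have "\<dots> \<le> card exceptional" by (intro card_mono) auto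
  finally show "2 \<le> card exceptional" .
  have "card exceptional \<le> card {C, ?D}"
  proof (rule card_exceptional_eigenvalues_le)
    fix x :: "'a \<Rightarrow> real" and t
    assume "\<And>A. A \<in> {C, ?D} \<Longrightarrow> (\<Sum>w\<in>A. x w) = 0" and t: "t \<in> ?V"
    then have x: "(\<Sum>w\<in>C. x w) = 0" "(\<Sum>w\<in>?D. x w) = 0" by auto
    \<comment> \<open>A row that is constant on a class contributes nothing, since \<open>x\<close>
      sums to zero there.\<close>
    have block: "(\<Sum>w\<in>A. h w * x w) = 0"
      if "A \<in> {C, ?D}" "\<And>w. w \<in> A \<Longrightarrow> h w = r" for A h and r :: real
      using that x by (auto simp: sum_distrib_left[symmetric] cong: sum.cong)
    have yC: "(\<Sum>z\<in>?V. shifted 2 w z * x z) = 0" if "w \<in> C" for w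
    proof -
      have "(\<Sum>z\<in>C. shifted 2 w z * x z) = 0" "(\<Sum>z\<in>?D. shifted 2 w z * x z) = 0"
        by (rule block[of C _ 2], use that shC in auto) (rule block[of ?D _ 1], use that sh1 in auto)
      then show ?thesis unfolding sum_split[OF CV] by simp
    qed
    show "(\<Sum>w\<in>?V. shifted 1 t w * (\<Sum>z\<in>?V. shifted 2 w z * x z)) = 0"
    proof (cases "complete_bipartition G C")
      case True
      have shD: "shifted 2 y z = 2" if "y \<in> ?D" "z \<in> ?D" for y z
      proof (cases "y = z")
        case False
        have "(y, z) \<notin> parcs G"
          using True that unfolding complete_bipartition_def by blast
        with cross[OF uw(1)] that False show ?thesis by (intro shifted_two[of y u z])
      qed (use that shifted_self in auto)
      have "(\<Sum>z\<in>?V. shifted 2 w z * x z) = 0" if "w \<in> ?D" for w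
      proof -
        have "(\<Sum>z\<in>C. shifted 2 w z * x z) = 0" "(\<Sum>z\<in>?D. shifted 2 w z * x z) = 0"
          by (rule block[of C _ 1], use that sh1 in auto) (rule block[of ?D _ 2], use that shD in auto)
        then show ?thesis unfolding sum_split[OF CV] by simp
      qed
      with yC have "(\<Sum>z\<in>?V. shifted 2 w z * x z) = 0" if "w \<in> ?V" for w
        using that by blast
      then show ?thesis by simp
    next
      case False
      with C(1) have split: "complete_split G C" by blast
      have shD: "shifted s y z = (if y = z then s else 1)" if "y \<in> ?D" "z \<in> ?D" for s y z
        using split that shifted_self[of y s] shifted_arc[of y z s]
        by (auto simp: complete_split_def)
      \<comment> \<open>On \<open>?D\<close> the row is constantly 1 except for an extra 1 on the
        diagonal, which returns \<open>x w\<close>.\<close>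
      have yD: "(\<Sum>z\<in>?V. shifted 2 w z * x z) = x w" if "w \<in> ?D" for w
      proof -
        have "(\<Sum>z\<in>?D. shifted 2 w z * x z) = (\<Sum>z\<in>?D. x z + (if w = z then x z else 0))"
          using that by (intro sum.cong refl) (simp add: shD)
        also have "\<dots> = x w" using x that finite_V by (simp add: sum.distrib)
        finally have "(\<Sum>z\<in>?D. shifted 2 w z * x z) = x w" .
        moreover have "(\<Sum>z\<in>C. shifted 2 w z * x z) = 0"
          by (rule block[of C _ 1]) (use that sh1 in auto)
        ultimately show ?thesis unfolding sum_split[OF CV] by simp
      qed
      \<comment> \<open>Only the coordinates in \<open>?D\<close> survive the first factor, and
        there every row of \<open>D + I\<close> is constantly 1.\<close>
      have "(\<Sum>w\<in>?V. shifted 1 t w * (\<Sum>z\<in>?V. shifted 2 w z * x z)) = (\<Sum>w\<in>?D. shifted 1 t w * x w)"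
        unfolding sum_split[OF CV, of "\<lambda>w. shifted 1 t w * _ w"] using yC yD by simp
      also have "\<dots> = 0"
      proof (rule block[of ?D _ 1])
        show "shifted 1 t w = 1" if "w \<in> ?D" for w
          using t that sh1[of t w] shD[of t w] by (cases "t \<in> C") auto
      qed simp
      finally show ?thesis .
    qed
  qed (use CV in auto)
  also have "\<dots> \<le> 2" by (simp add: card_insert_if)
  finally show "card exceptional \<le> 2" .
qed

text \<open>Once all eigenvalues are known to be at least -2, nonadjacent vertices are twins, and
  the nonneighbours of a vertex form an independent class \<open>C\<close> joined to everything
  else. The complement of \<open>C\<close> is independent, or else it contains an edge and must be a
  clique; that edge gives the size bound in the split case.\<close>

lemma card_exceptional_eq_2D:
  assumes card2: "card exceptional = 2"
  shows "\<exists>C. (complete_bipartition G C \<or> complete_split G C \<and> 2 \<le> card (pverts G - C))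
    \<and> 2 \<le> card C \<and> C \<noteq> pverts G"
proof -
  let ?V = "pverts G" and ?P = "{i \<in> {..<n}. ev i > - 1}"
  obtain x y where "x \<in> ?V" "y \<in> ?V" "x \<noteq> y" "(x, y) \<notin> parcs G"
    using complete_imp_card_exceptional_le_1 card2 by fastforce
  from induced_path_exists[OF this] obtain u v w where
    uvw: "(u, v) \<in> parcs G" "(v, w) \<in> parcs G" "u \<noteq> w" "(u, w) \<notin> parcs G" by blast
  then have V: "u \<in> ?V" "v \<in> ?V" "w \<in> ?V" by (auto dest: wellformed')
  \<comment> \<open>Every index in \<open>?P\<close> is exceptional and the induced path supplies
    two of them, so the inclusion is an equality. The remaining eigenvalues are -1 or -2.\<close>
  have "?P = exceptional"
    using two_eigenvalues_greater[OF uvw] card2 by (intro card_seteq) auto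
  then have card_P: "card ?P = 2" using card2 by simp
  have ge: "ev i \<ge> - 2" if "i < n" for i
  proof (cases "i \<in> exceptional")
    case True
    then have "i \<in> ?P" using \<open>?P = exceptional\<close> by blast
    then show ?thesis by simp
  next
    case False
    then show ?thesis using that by auto
  qed
  have twins: "shifted 2 x y = shifted 2 z y"
    if xz: "x \<in> ?V" "z \<in> ?V" "x \<noteq> z" "(x, z) \<notin> parcs G" and y: "y \<in> ?V" for x z y
  proof -
    \<comment> \<open>\<open>h\<close> is the difference of the unit vectors at \<open>x\<close> and
      \<open>z\<close>. Its form under \<open>D + 2I\<close> is \<open>4 - 2 * d(x, z)\<close>,
      nonpositive by nonadjacency, and membership in the kernel says that the rows of
      \<open>x\<close> and \<open>z\<close> agree.\<close>
    define h :: "'a \<Rightarrow> real" where "h = (\<lambda>t. (if t = x then 1 else 0) - (if t = z then 1 else 0))"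
    have apply_h: "(\<Sum>t\<in>?V. k t * h t) = k x - k z" for k
    proof -
      have "(\<Sum>t\<in>?V. k t * h t) = (\<Sum>t\<in>?V. (if t = x then k t else 0) - (if t = z then k t else 0))"
        unfolding h_def by (intro sum.cong refl) auto
      then show ?thesis using xz finite_V by (simp add: sum_subtractf)
    qed
    have "graph_dist G x z \<noteq> 0" "graph_dist G x z \<noteq> 1"
      using graph_dist_eq_0_iff[OF xz(1,2)] graph_dist_eq_1_iff[OF xz(1,2)] xz by auto
    then have "graph_dist G x z \<ge> 2" by linarith
    then have d: "shifted 2 x z \<ge> 2" "shifted 2 z x \<ge> 2"
      using xz(3) graph_dist_commute[of z x] by (auto simp: shifted_def)
    have "(\<Sum>s\<in>?V. \<Sum>t\<in>?V. h s * h t * shifted 2 s t)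
        = (\<Sum>s\<in>?V. (\<Sum>t\<in>?V. shifted 2 s t * h t) * h s)"
      by (simp add: sum_distrib_left sum_distrib_right mult_ac)
    also have "\<dots> = (shifted 2 x x - shifted 2 x z) - (shifted 2 z x - shifted 2 z z)"
      unfolding apply_h by simp
    also have "\<dots> \<le> 0" using d xz by (simp add: shifted_self)
    finally have "(\<Sum>t\<in>?V. shifted 2 y t * h t) = 0"
      using ge y by (intro isotropic_imp_kernel) auto
    then have "shifted 2 y x = shifted 2 y z" unfolding apply_h by simp
    then show ?thesis using graph_dist_commute by (auto simp: shifted_def)
  qed
  \<comment> \<open>With shift 2 the diagonal entries are 2 and the others are distances, so the
    value 1 detects adjacency exactly.\<close>
  have arc_iff: "(x, y) \<in> parcs G \<longleftrightarrow> shifted 2 x y = 1" if "x \<in> ?V" "y \<in> ?V" for x y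
    using that graph_dist_eq_1_iff[OF that] arc_neq[of x y] by (auto simp: shifted_def)
  have transfer: "(x, y) \<in> parcs G \<longleftrightarrow> (z, y) \<in> parcs G"
    if "x \<in> ?V" "z \<in> ?V" "(x, z) \<notin> parcs G" "y \<in> ?V" for x z y
    using twins[of x z y] that arc_iff by (cases "x = z") auto
  \<comment> \<open>The class contains \<open>u\<close> itself, as there are no loops. Its members
    have the same neighbours as \<open>u\<close>, so no two of them are adjacent.\<close>
  define C where "C = {z \<in> ?V. (u, z) \<notin> parcs G}"
  have CV: "C \<subseteq> ?V" unfolding C_def by blast
  have C_iff: "(x, y) \<in> parcs G \<longleftrightarrow> y \<notin> C" if "x \<in> C" "y \<in> ?V" for x y
    using transfer[of u x y] that V(1) unfolding C_def by blast
  have C_iff': "(y, x) \<in> parcs G \<longleftrightarrow> y \<notin> C" if "x \<in> C" "y \<in> ?V" for x y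
    using C_iff[OF that] arc_commute by blast
  have uC: "u \<in> C" "w \<in> C" "v \<notin> C" using V uvw arc_neq unfolding C_def by auto
  have "card {u, w} \<le> card C" using uC finite_V CV by (intro card_mono) (auto intro: finite_subset)
  then have cardC: "2 \<le> card C" using uvw(3) by simp
  show ?thesis
  proof (cases "\<exists>x y. x \<in> ?V - C \<and> y \<in> ?V - C \<and> (x, y) \<in> parcs G")
    case False
    then have "complete_bipartition G C"
      unfolding complete_bipartition_def using CV C_iff C_iff' by blast
    then show ?thesis using cardC uC V by blast
  next
    case True
    then obtain x y where xy: "x \<in> ?V - C" "y \<in> ?V - C" "(x, y) \<in> parcs G" by blast
    have "(p, q) \<in> parcs G" if pq: "p \<in> ?V - C" "q \<in> ?V - C" "p \<noteq> q" for p q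
    proof (rule ccontr)
      assume npq: "(p, q) \<notin> parcs G"
      \<comment> \<open>If \<open>p\<close> is not adjacent to \<open>x\<close>, it has the
        neighbours of \<open>x\<close> and is adjacent to \<open>y\<close>; so \<open>x\<close> or
        \<open>y\<close> serves as \<open>z\<close>. Then \<open>{u, w}\<close>,
        \<open>{p, q}\<close> and \<open>{z}\<close> are the classes of an induced
        \<open>K_{1,2,2}\<close>.\<close>
      obtain z where z: "z \<in> ?V - C" "(p, z) \<in> parcs G"
        using xy transfer[of p x y] pq by blast
      then have "(q, z) \<in> parcs G" using transfer[of p q z] pq npq by blast
      then have "3 \<le> card ?P"
        using three_eigenvalues_greater[of u p q w z] uC pq npq z uvw(3,4) C_iff by auto
      then show False using card_P by simp
    qed
    then have "complete_split G C"
      unfolding complete_split_def using CV C_iff C_iff' arc_neq by blast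
    moreover have "card {x, y} \<le> card (?V - C)" using xy finite_V by (intro card_mono) auto
    then have "2 \<le> card (?V - C)" using arc_neq[OF xy(3)] by simp
    ultimately show ?thesis using cardC uC V by blast
  qed
qed

end

section \<open>Vertex classes and isomorphism with the model graphs\<close>

text \<open>An isomorphism also carries maps for arcs, heads and tails. In a pair graph an arc is
  the pair of its ends, so a vertex bijection that preserves and reflects adjacency is all the
  information needed.\<close>

lemma digraph_iso_pair_iff:
  assumes "pair_wf_digraph G" "pair_wf_digraph H"
  shows "digraph_iso (with_proj G) (with_proj H) \<longleftrightarrow>
    (\<exists>h. bij_betw h (pverts G) (pverts H) \<and>
      (\<forall>u\<in>pverts G. \<forall>w\<in>pverts G. (u, w) \<in> parcs G \<longleftrightarrow> (h u, h w) \<in> parcs H))"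
proof -
  interpret G: pair_wf_digraph G by fact
  interpret H: pair_wf_digraph H by fact
  show ?thesis
  proof
    assume "digraph_iso (with_proj G) (with_proj H)"
    then obtain f where f: "pre_digraph.digraph_isomorphism (with_proj G) f"
      "with_proj H = app_iso f (with_proj G)" unfolding digraph_iso_def by blast
    have inj: "inj_on (iso_verts f) (pverts G)" using G.digraph_isomorphism_inj_on_verts[OF f(1)] .
    have "verts (with_proj H) = iso_verts f ` pverts G" unfolding f(2) by simp
    then have verts: "pverts H = iso_verts f ` pverts G" by simp
    have "arcs_ends (with_proj H) = (\<lambda>(u, v). (iso_verts f u, iso_verts f v)) ` parcs G"
      unfolding f(2) using G.arcs_ends_app_iso_eq[OF f(1)] by simp
    then have arcs: "parcs H = (\<lambda>(u, v). (iso_verts f u, iso_verts f v)) ` parcs G" by simp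
    have "(u, w) \<in> parcs G"
      if uw: "u \<in> pverts G" "w \<in> pverts G" "(iso_verts f u, iso_verts f w) \<in> parcs H" for u w
    proof -
      from uw(3) obtain a c where ac: "(a, c) \<in> parcs G" "iso_verts f u = iso_verts f a"
        "iso_verts f w = iso_verts f c" unfolding arcs by auto
      moreover from ac(1) have "a \<in> pverts G" "c \<in> pverts G" by (auto dest: G.wellformed')
      ultimately show ?thesis using inj uw(1,2) by (metis inj_onD)
    qed
    moreover have "(iso_verts f u, iso_verts f w) \<in> parcs H" if "(u, w) \<in> parcs G" for u w
      using that unfolding arcs by force
    moreover have "bij_betw (iso_verts f) (pverts G) (pverts H)"
      using inj verts by (simp add: bij_betw_def)
    ultimately show "\<exists>h. bij_betw h (pverts G) (pverts H) \<and>
      (\<forall>u\<in>pverts G. \<forall>w\<in>pverts G. (u, w) \<in> parcs G \<longleftrightarrow> (h u, h w) \<in> parcs H)" by blast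
  next
    assume "\<exists>h. bij_betw h (pverts G) (pverts H) \<and>
      (\<forall>u\<in>pverts G. \<forall>w\<in>pverts G. (u, w) \<in> parcs G \<longleftrightarrow> (h u, h w) \<in> parcs H)"
    then obtain h where h: "inj_on h (pverts G)" "pverts H = h ` pverts G"
      "\<And>u w. \<lbrakk>u \<in> pverts G; w \<in> pverts G\<rbrakk> \<Longrightarrow> (u, w) \<in> parcs G \<longleftrightarrow> (h u, h w) \<in> parcs H"
      unfolding bij_betw_def by blast
    \<comment> \<open>The arc map is induced by the vertex map, and head and tail are again the
      projections, so the image is literally a pair graph.\<close>
    define f where "f = \<lparr>iso_verts = h, iso_arcs = map_prod h h, iso_head = snd, iso_tail = fst\<rparr>"
    have sub: "parcs G \<subseteq> pverts G \<times> pverts G" by (auto dest: G.wellformed')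
    have "parcs H = map_prod h h ` parcs G"
    proof (intro equalityI subsetI)
      fix e assume e: "e \<in> parcs H"
      obtain a c where ac: "e = (a, c)" by (cases e)
      then have "a \<in> h ` pverts G" "c \<in> h ` pverts G" using H.wellformed' e unfolding h(2)[symmetric] by blast+
      then obtain u w where uw: "a = h u" "c = h w" "u \<in> pverts G" "w \<in> pverts G" by blast
      then have "(u, w) \<in> parcs G" using h(3) e ac by blast
      then show "e \<in> map_prod h h ` parcs G" using ac uw(1,2) by (intro image_eqI[of _ _ "(u, w)"]) auto
    next
      fix e assume "e \<in> map_prod h h ` parcs G"
      then obtain u w where uw: "(u, w) \<in> parcs G" "e = (h u, h w)" by auto
      with sub h(3)[of u w] show "e \<in> parcs H" by blast
    qed
    then have "with_proj H = app_iso f (with_proj G)"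
      unfolding f_def using h(2) by (simp add: with_proj_def app_iso_def)
    moreover have "G.digraph_isomorphism f"
      unfolding G.digraph_isomorphism_def f_def
      using h(1) inj_on_subset[OF map_prod_inj_on[OF h(1) h(1)] sub] G.wf_digraph_axioms by simp
    ultimately show "digraph_iso (with_proj G) (with_proj H)" unfolding digraph_iso_def by blast
  qed
qed

text \<open>\<open>C\<close> corresponds to the left summand of the join: it is the preimage of that
  summand under an isomorphism, and conversely bijections of \<open>C\<close> and of its complement
  with the two index ranges glue to an isomorphism.\<close>

lemma digraph_iso_join_iff:
  assumes "pair_wf_digraph G" and fin: "finite (pverts G)"
  shows "digraph_iso (with_proj G) (with_proj (graph_join (edgeless_graph s) (complete_graph t)))
    \<longleftrightarrow> (\<exists>C. complete_split G C \<and> card C = s \<and> card (pverts G - C) = t)"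
proof -
  let ?H = "graph_join (edgeless_graph s) (complete_graph t)"
  have wfH: "pair_wf_digraph ?H"
    using pair_graph_graph_join[OF pair_graph_edgeless_graph pair_graph_complete_graph]
    by (simp add: pair_graph_def pair_digraph_def pair_fin_digraph_def)
  have VH: "pverts ?H = Inl ` {..<s} \<union> Inr ` {..<t}"
    by (auto simp: graph_join_def edgeless_graph_def complete_graph_def)
  have EH: "(a, b) \<in> parcs ?H \<longleftrightarrow> a \<noteq> b \<and> \<not> (a \<in> Inl ` {..<s} \<and> b \<in> Inl ` {..<s})"
    if "a \<in> pverts ?H" "b \<in> pverts ?H" for a b
    using that by (auto simp: graph_join_def edgeless_graph_def complete_graph_def)
  show ?thesis unfolding digraph_iso_pair_iff[OF assms(1) wfH]
  proof
    assume "\<exists>h. bij_betw h (pverts G) (pverts ?H) \<and>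
      (\<forall>u\<in>pverts G. \<forall>w\<in>pverts G. (u, w) \<in> parcs G \<longleftrightarrow> (h u, h w) \<in> parcs ?H)"
    then obtain h where h: "inj_on h (pverts G)" "h ` pverts G = pverts ?H"
      "\<And>u w. \<lbrakk>u \<in> pverts G; w \<in> pverts G\<rbrakk> \<Longrightarrow> (u, w) \<in> parcs G \<longleftrightarrow> (h u, h w) \<in> parcs ?H"
      unfolding bij_betw_def by blast
    define C where "C = {u \<in> pverts G. h u \<in> Inl ` {..<s}}"
    have hV: "h u \<in> pverts ?H" if "u \<in> pverts G" for u using h(2) that by blast
    have "(u, w) \<in> parcs G \<longleftrightarrow> u \<noteq> w \<and> \<not> (u \<in> C \<and> w \<in> C)"
      if "u \<in> pverts G" "w \<in> pverts G" for u w
      using h(3)[OF that] EH[OF hV[OF that(1)] hV[OF that(2)]] inj_on_eq_iff[OF h(1) that] that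
      by (simp add: C_def)
    then have "complete_split G C" unfolding complete_split_def C_def by blast
    moreover have "h ` C = h ` pverts G \<inter> Inl ` {..<s}" "h ` (pverts G - C) = h ` pverts G - Inl ` {..<s}"
      unfolding C_def by auto
    then have "h ` C = Inl ` {..<s}" "h ` (pverts G - C) = Inr ` {..<t}"
      unfolding h(2) VH by auto
    moreover have "card (h ` C) = card C" "card (h ` (pverts G - C)) = card (pverts G - C)"
      by (intro card_image inj_on_subset[OF h(1)]; auto simp: C_def)+
    ultimately have "complete_split G C" "card C = s" "card (pverts G - C) = t"
      by (auto simp: card_image)
    then show "\<exists>C. complete_split G C \<and> card C = s \<and> card (pverts G - C) = t" by blast
  next
    assume "\<exists>C. complete_split G C \<and> card C = s \<and> card (pverts G - C) = t"
    then obtain C where C: "complete_split G C" "card C = s" "card (pverts G - C) = t" by blast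
    have CV: "C \<subseteq> pverts G" using C(1) unfolding complete_split_def by blast
    obtain f where f: "bij_betw f C {..<s}"
      using C(2) finite_subset[OF CV fin] by (metis atLeast0LessThan ex_bij_betw_finite_nat)
    obtain g where g: "bij_betw g (pverts G - C) {..<t}"
      using C(3) fin by (metis atLeast0LessThan ex_bij_betw_finite_nat finite_Diff)
    define h where "h = (\<lambda>u. if u \<in> C then Inl (f u) else Inr (g u))"
    have "bij_betw h C (Inl ` {..<s})"
      using f by (auto simp: bij_betw_def inj_on_def h_def image_iff)
    moreover have "bij_betw h (pverts G - C) (Inr ` {..<t})"
      using g by (auto simp: bij_betw_def inj_on_def h_def image_iff)
    ultimately have bij: "bij_betw h (pverts G) (pverts ?H)"
      using bij_betw_combine[of h C _ "pverts G - C"] CV unfolding VH by (auto simp: Un_absorb1)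
    have hC: "h u \<in> Inl ` {..<s} \<longleftrightarrow> u \<in> C" if "u \<in> pverts G" for u
      using f by (auto simp: h_def bij_betw_def)
    have "(u, w) \<in> parcs G \<longleftrightarrow> (h u, h w) \<in> parcs ?H" if "u \<in> pverts G" "w \<in> pverts G" for u w
    proof -
      have "h u \<in> pverts ?H" "h w \<in> pverts ?H" using that bij by (auto simp: bij_betw_def)
      moreover have "h u = h w \<longleftrightarrow> u = w" using that bij by (auto simp: bij_betw_def inj_on_eq_iff)
      moreover have "(u, w) \<in> parcs G \<longleftrightarrow> u \<noteq> w \<and> \<not> (u \<in> C \<and> w \<in> C)"
        using C(1) that unfolding complete_split_def by blast
      ultimately show ?thesis using EH[of "h u" "h w"] hC that by simp
    qed
    with bij show "\<exists>h. bij_betw h (pverts G) (pverts ?H) \<and>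
      (\<forall>u\<in>pverts G. \<forall>w\<in>pverts G. (u, w) \<in> parcs G \<longleftrightarrow> (h u, h w) \<in> parcs ?H)" by blast
  qed
qed

text \<open>Of the two disjoint parts covering the vertices, the second is forced to be the
  complement of the first, so one class carries all the data.\<close>

lemma complete_bipartite_digraph_iff:
  assumes "pair_wf_digraph G" "finite (pverts G)"
  shows "complete_bipartite_digraph s t (with_proj G)
    \<longleftrightarrow> (\<exists>C. complete_bipartition G C \<and> card C = s \<and> card (pverts G - C) = t)"
proof -
  interpret pair_wf_digraph G by fact
  have bip: "parcs G = C \<times> (pverts G - C) \<union> (pverts G - C) \<times> C \<longleftrightarrow> complete_bipartition G C"
    if "C \<subseteq> pverts G" for C
    using that unfolding complete_bipartition_def
    by (auto dest: wellformed')
  have "(\<exists>U W. pverts G = U \<union> W \<and> U \<inter> W = {} \<and> card U = s \<and> card W = t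
      \<and> parcs G = U \<times> W \<union> W \<times> U)
    \<longleftrightarrow> (\<exists>C\<subseteq>pverts G. card C = s \<and> card (pverts G - C) = t
      \<and> parcs G = C \<times> (pverts G - C) \<union> (pverts G - C) \<times> C)" (is "?L \<longleftrightarrow> ?R")
  proof
    assume ?L
    then obtain U W where UW: "pverts G = U \<union> W" "U \<inter> W = {}" "card U = s" "card W = t"
      "parcs G = U \<times> W \<union> W \<times> U" by blast
    then have "W = pverts G - U" "U \<subseteq> pverts G" by blast+
    with UW(3-5) show ?R by (intro exI[of _ U]) simp
  next
    assume ?R
    then obtain C where C: "C \<subseteq> pverts G" "card C = s" "card (pverts G - C) = t"
      "parcs G = C \<times> (pverts G - C) \<union> (pverts G - C) \<times> C" by (elim exE conjE)
    then show ?L by (intro exI[of _ C] exI[of _ "pverts G - C"]) (simp add: Un_absorb1)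
  qed
  moreover have "?R \<longleftrightarrow> (\<exists>C. complete_bipartition G C \<and> card C = s \<and> card (pverts G - C) = t)"
  proof (rule ex_cong1)
    fix C
    show "(C \<subseteq> pverts G \<and> card C = s \<and> card (pverts G - C) = t
        \<and> parcs G = C \<times> (pverts G - C) \<union> (pverts G - C) \<times> C)
      \<longleftrightarrow> complete_bipartition G C \<and> card C = s \<and> card (pverts G - C) = t"
    proof (cases "C \<subseteq> pverts G")
      case True
      then show ?thesis unfolding bip[OF True] by auto
    next
      case False
      then show ?thesis unfolding complete_bipartition_def by simp
    qed
  qed
  ultimately show ?thesis
    unfolding complete_bipartite_digraph_pair_def using assms(2) by simp
qed

section \<open>Multiplicities, exceptional eigenvalues and the two families\<close>

theorem theorem4p1:
  fixes G :: "'a pair_pre_digraph" and vs :: "'a list" and n :: nat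
  assumes "pair_graph G"
    and "Digraph_Component.connected (with_proj G)"
    and "card (pverts G) = n"
    and "n \<ge> 4"
    and "distinct vs" and "set vs = pverts G"
  shows "eigenvalue_mult (distance_matrix G vs) (-1) + eigenvalue_mult (distance_matrix G vs) (-2)
           = n - 2
    \<longleftrightarrow> (\<exists>s. 1 \<le> s \<and> s \<le> n - 1 \<and> complete_bipartite_digraph s (n - s) (with_proj G))
      \<or> (\<exists>s. 2 \<le> s \<and> s \<le> n - 2 \<and>
            digraph_iso (with_proj G)
              (with_proj (graph_join (edgeless_graph s) (complete_graph (n - s)))))"
proof -
  interpret connected_pair_graph G
    using assms(1,2) by (simp add: connected_pair_graph_def connected_pair_graph_axioms_def)
  let ?V = "pverts G"
  have n: "n = length vs" using assms(3,5,6) distinct_card by metis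
  have fin: "finite ?V" using assms(6) by (metis List.finite_set)
  let ?d = "\<lambda>u w. real (graph_dist G u w)"
  have "?d u w = ?d w u" for u w by (simp only: graph_dist_commute)
  with assms(5) obtain ev b where basis: "orthonormal_eigenbasis (set vs) (length vs) ?d ev b"
    and char: "char_poly (distance_matrix G vs) = (\<Prod>i<length vs. [:- ev i, 1:])"
    unfolding distance_matrix_def by (rule orthonormal_eigenbasis_exists)
  interpret distance_eigenbasis G n ev b
    using basis connected_pair_graph_axioms assms(6) n by (simp add: distance_eigenbasis_def)
  have mult: "eigenvalue_mult (distance_matrix G vs) c = card {i \<in> {..<n}. ev i = c}" for c
    unfolding eigenvalue_mult_def char n by (rule order_prod_linear_factors) simp
  have "{..<n} = {i \<in> {..<n}. ev i = - 1} \<union> {i \<in> {..<n}. ev i = - 2} \<union> exceptional" by auto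
  then have "n = card ({i \<in> {..<n}. ev i = - 1} \<union> {i \<in> {..<n}. ev i = - 2} \<union> exceptional)"
    by (metis card_lessThan)
  also have "\<dots> = card {i \<in> {..<n}. ev i = - 1} + card {i \<in> {..<n}. ev i = - 2} + card exceptional"
    by (subst card_Un_disjoint; (subst card_Un_disjoint)?; auto)
  \<comment> \<open>The indices with value -1, with value -2 and the exceptional ones add up to
    \<open>n\<close>; since \<open>n\<close> is at least 4, the subtraction \<open>n - 2\<close>
    does not truncate.\<close>
  finally have "eigenvalue_mult (distance_matrix G vs) (-1) + eigenvalue_mult (distance_matrix G vs) (-2)
      = n - 2 \<longleftrightarrow> card exceptional = 2"
    unfolding mult using assms(4) by linarith
  also have "\<dots> \<longleftrightarrow> (\<exists>C. (complete_bipartition G C \<or> complete_split G C \<and> 2 \<le> card (?V - C))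
      \<and> 2 \<le> card C \<and> C \<noteq> ?V)"
    using card_exceptional_eq_2D card_exceptional_eq_2I by blast
  also have "\<dots> \<longleftrightarrow> (\<exists>s C. 1 \<le> s \<and> s \<le> n - 1 \<and> complete_bipartition G C \<and> card C = s \<and> card (?V - C) = n - s)
      \<or> (\<exists>s C. 2 \<le> s \<and> s \<le> n - 2 \<and> complete_split G C \<and> card C = s \<and> card (?V - C) = n - s)"
    (is "?L \<longleftrightarrow> ?B \<or> ?S")
  proof
    assume ?L
    then obtain C where C: "complete_bipartition G C \<or> complete_split G C \<and> 2 \<le> card (?V - C)"
      "2 \<le> card C" "C \<noteq> ?V" by blast
    then have CV: "C \<subseteq> ?V" by (auto simp: complete_bipartition_def complete_split_def)
    have "card C < n" using psubset_card_mono[OF fin, of C] CV C(3) assms(3) by blast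
    moreover have "card (?V - C) = n - card C"
      using card_Diff_subset[OF finite_subset[OF CV fin] CV] assms(3) by simp
    ultimately have card: "card C \<le> n - 1" "card (?V - C) = n - card C" by auto
    from C(1) show "?B \<or> ?S"
    proof
      assume "complete_bipartition G C"
      with card C(2) have ?B by (intro exI[of _ "card C"] exI[of _ C]) auto
      then show ?thesis ..
    next
      assume "complete_split G C \<and> 2 \<le> card (?V - C)"
      with card C(2) have ?S by (intro exI[of _ "card C"] exI[of _ C]) auto
      then show ?thesis ..
    qed
  next
    assume "?B \<or> ?S"
    then show ?L
    proof
      assume ?B
      then obtain C where C: "1 \<le> card C" "card C \<le> n - 1" "complete_bipartition G C"
        "card (?V - C) = n - card C" by blast
      then have CV: "C \<subseteq> ?V" unfolding complete_bipartition_def by blast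
      have ne: "C \<noteq> ?V" using C(2) assms(3,4) by auto
      show ?L
      proof (cases "2 \<le> card C")
        case True
        then show ?thesis using C(3) ne by blast
      next
        case False
        \<comment> \<open>A complete bipartition is symmetric in its classes, so a singleton class
          is replaced by its complement, which has \<open>n - 1\<close> vertices.\<close>
        have "complete_bipartition G (?V - C)" using C(3) unfolding complete_bipartition_def by blast
        moreover have "2 \<le> card (?V - C)" using False C(4) assms(4) by linarith
        moreover have "?V - C \<noteq> ?V" using C(1) CV by (metis Diff_disjoint card.empty inf.absorb_iff2 inf_commute not_one_le_zero)
        ultimately show ?thesis by blast
      qed
    next
      assume ?S
      then obtain C where C: "2 \<le> card C" "card C \<le> n - 2" "complete_split G C"
        "card (?V - C) = n - card C" by blast
      then have "2 \<le> card (?V - C)" "C \<noteq> ?V" using assms(3,4) by auto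
      then show ?L using C by blast
    qed
  qed
  also have "\<dots> \<longleftrightarrow> (\<exists>s. 1 \<le> s \<and> s \<le> n - 1 \<and> complete_bipartite_digraph s (n - s) (with_proj G))
      \<or> (\<exists>s. 2 \<le> s \<and> s \<le> n - 2 \<and> digraph_iso (with_proj G)
              (with_proj (graph_join (edgeless_graph s) (complete_graph (n - s)))))"
    unfolding complete_bipartite_digraph_iff[OF pair_wf_digraph_axioms fin]
      digraph_iso_join_iff[OF pair_wf_digraph_axioms fin] by blast
  finally show ?thesis .
qed

end
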